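(* Let $V$ be a Hilbert space with a localizing space decomposition with local spaces $V_1,\dots,V_N$ and mappings $\mathcal{P}_{V_i}:V\to V_i$. Suppose that $\{1,\dots,N\}=\dot\bigcup_{k=1}^{\bar J}\Upsilon_{C,k}$ is a partition into $\bar J$ classes such that $V_i\perp V_j$ whenever $i\neq j$ belong to the same class. Let $\widetilde V\subseteq V$ be a subspace, let $P_{\widetilde V\cap V_i}$ denote the orthogonal projection onto $\widetilde V\cap V_i$, and define $$c_{i,\widetilde V}:=\sup_{\varphi\in V\setminus\{0\}}\frac{\|(1-P_{\widetilde V\cap V_i})\mathcal{P}_{V_i}(\varphi)\|}{\|\varphi\|},\qquad i=1,\dots,N .$$ Then for every continuous linear functional $F$ on $V$ with $F(\varphi)=0$ for all $\varphi\in\widetilde V$, $$\|F\|_{V'}\le\sum_{i=1}^N c_{i,\widetilde V}\,\|F\|_{V_i'}\le\Big(\sum_{i=1}^N c_{i,\widetilde V}^2\Big)^{1/2}\sqrt{\bar J}\,\|F\|_{V'} .$$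
   Context: A localizing space decomposition consists of: an open, bounded, connected domain $\Omega\subset\mathbb{R}^d$ with smooth boundary; a Hilbert space $V$ of functions on $\Omega$ (over $\mathbb{R}$ or $\mathbb{C}$; continuous or discrete); subdomains $\omega_1,\dots,\omega_N$ forming an overlapping or non-overlapping domain decomposition of $\Omega$; subspaces $V_1,\dots,V_N\subseteq V$ with $\sum_i V_i=V$ and $\operatorname{supp}\varphi\subseteq\omega_i$ for all $\varphi\in V_i$; and linear maps $\mathcal{P}_{V_i}:V\to V_i$ with $\sum_{i=1}^N\mathcal{P}_{V_i}(\varphi)=\varphi$ for all $\varphi\in V$. Each $V_i$ carries the norm of $V$; for a subspace $W\subseteq V$, $\|F\|_{W'}:=\sup_{\varphi\in W\setminus\{0\}}|F(\varphi)|/\|\varphi\|$. Conventions: subspaces onto which orthogonal projections are taken are understood to be closed; constants defined as suprema may take the value $+\infty$, with $0\cdot\infty=0$. *)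

theory Defs
  imports "HOL-Analysis.Analysis"
begin

section \<open>Scalars and Hilbert spaces\<close>

text \<open>The last axiom says that the field is, up to isomorphism, either the reals or the complex
  numbers; together with the others it forces \<open>conjg\<close> to be the identity or complex conjugation.\<close>

class real_or_complex = real_normed_field +
  fixes conjg :: "'a \<Rightarrow> 'a"
  assumes conjg_add: "conjg (x + y) = conjg x + conjg y"
    and conjg_mult: "conjg (x * y) = conjg x * conjg y"
    and conjg_scaleR_one: "conjg (r *\<^sub>R 1) = r *\<^sub>R 1"
    and mult_conjg: "x * conjg x = (norm x)\<^sup>2 *\<^sub>R 1"
    and real_or_complex:
      "(\<forall>x. \<exists>a. x = a *\<^sub>R 1) \<or> (\<exists>j. j * j = - 1 \<and> (\<forall>x. \<exists>a b. x = a *\<^sub>R 1 + b *\<^sub>R j))"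

instantiation real :: real_or_complex
begin

definition conjg_real :: "real \<Rightarrow> real" where "conjg_real x = x"

instance
  by standard (auto simp: conjg_real_def power2_eq_square)

end

instantiation complex :: real_or_complex
begin

definition conjg_complex :: "complex \<Rightarrow> complex" where "conjg_complex x = cnj x"

instance
proof
  fix x y :: complex and r :: real
  show "conjg (x + y) = conjg x + conjg y" "conjg (x * y) = conjg x * conjg y"
    "conjg (r *\<^sub>R 1 :: complex) = r *\<^sub>R 1"
    by (simp_all add: conjg_complex_def)
  show "x * conjg x = (norm x)\<^sup>2 *\<^sub>R 1"
    by (simp add: conjg_complex_def scaleR_conv_of_real complex_norm_square flip: of_real_power)
  have "\<i> * \<i> = - 1 \<and> (\<forall>z. \<exists>a b. z = a *\<^sub>R 1 + b *\<^sub>R \<i>)"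
  proof (intro conjI allI)
    fix z :: complex
    show "\<exists>a b. z = a *\<^sub>R 1 + b *\<^sub>R \<i>"
      by (rule exI[of _ "Re z"], rule exI[of _ "Im z"]) (simp add: complex_eq_iff)
  qed simp
  then show "(\<forall>z::complex. \<exists>a. z = a *\<^sub>R 1) \<or>
      (\<exists>j. j * j = - 1 \<and> (\<forall>z::complex. \<exists>a b. z = a *\<^sub>R 1 + b *\<^sub>R j))"
    by blast
qed

end

text \<open>A Hilbert space over \<open>'k\<close>: the Banach space \<open>'v\<close> supplies the norm and completeness, and the
  Hermitian form \<open>ip\<close> induces that norm.\<close>

locale hilbert_space = vector_space scale
  for scale :: "'k::real_or_complex \<Rightarrow> 'v::banach \<Rightarrow> 'v" +
  fixes ip :: "'v \<Rightarrow> 'v \<Rightarrow> 'k"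
  assumes scale_of_real: "scale (of_real r) x = r *\<^sub>R x"
    and ip_add_left: "ip (x + y) z = ip x z + ip y z"
    and ip_scale_left: "ip (scale a x) y = a * ip x y"
    and ip_conjg: "ip y x = conjg (ip x y)"
    and ip_self: "ip x x = of_real ((norm x)\<^sup>2)"

definition orthogonal_sets :: "('v \<Rightarrow> 'v \<Rightarrow> 'k::zero) \<Rightarrow> 'v set \<Rightarrow> 'v set \<Rightarrow> bool" where
  "orthogonal_sets ip A B \<longleftrightarrow> (\<forall>x\<in>A. \<forall>y\<in>B. ip x y = 0)"

text \<open>Meaningful when \<open>W\<close> is a closed subspace of a Hilbert space.\<close>

definition orth_proj :: "('v::ab_group_add \<Rightarrow> 'v \<Rightarrow> 'k::zero) \<Rightarrow> 'v set \<Rightarrow> 'v \<Rightarrow> 'v" where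
  "orth_proj ip W x = (THE p. p \<in> W \<and> (\<forall>w\<in>W. ip (x - p) w = 0))"


section \<open>Domains and domain decompositions\<close>

fun Ck_on :: "nat \<Rightarrow> 'a::euclidean_space set \<Rightarrow> ('a \<Rightarrow> real) \<Rightarrow> bool" where
  "Ck_on 0 U f \<longleftrightarrow> continuous_on U f"
| "Ck_on (Suc k) U f \<longleftrightarrow> (\<forall>x\<in>U. f differentiable (at x)) \<and>
     (\<forall>v. Ck_on k U (\<lambda>x. frechet_derivative f (at x) v))"

text \<open>Near each boundary point, the set is the strict sublevel set of a smooth function with
  non-vanishing derivative.\<close>

definition smooth_boundary :: "'a::euclidean_space set \<Rightarrow> bool" where
  "smooth_boundary \<Omega> \<longleftrightarrow> (\<forall>p\<in>frontier \<Omega>. \<exists>U \<rho>. open U \<and> p \<in> U \<and> (\<forall>k. Ck_on k U \<rho>) \<and>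
     (\<forall>x\<in>U. frechet_derivative \<rho> (at x) \<noteq> (\<lambda>_. 0)) \<and> \<Omega> \<inter> U = {x\<in>U. \<rho> x < 0})"

definition subdomains_cover :: "'a::topological_space set \<Rightarrow> nat \<Rightarrow> (nat \<Rightarrow> 'a set) \<Rightarrow> bool" where
  "subdomains_cover \<Omega> N \<omega> \<longleftrightarrow>
     (\<forall>i\<in>{1..N}. open (\<omega> i) \<and> \<omega> i \<noteq> {} \<and> \<omega> i \<subseteq> \<Omega>) \<and> closure \<Omega> = (\<Union>i\<in>{1..N}. closure (\<omega> i))"

definition nonoverlapping_decomposition ::
  "'a::topological_space set \<Rightarrow> nat \<Rightarrow> (nat \<Rightarrow> 'a set) \<Rightarrow> bool" where
  "nonoverlapping_decomposition \<Omega> N \<omega> \<longleftrightarrow>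
     subdomains_cover \<Omega> N \<omega> \<and> (\<forall>i\<in>{1..N}. \<forall>j\<in>{1..N}. i \<noteq> j \<longrightarrow> \<omega> i \<inter> \<omega> j = {})"

definition overlapping_decomposition ::
  "'a::topological_space set \<Rightarrow> nat \<Rightarrow> (nat \<Rightarrow> 'a set) \<Rightarrow> bool" where
  "overlapping_decomposition \<Omega> N \<omega> \<longleftrightarrow>
     subdomains_cover \<Omega> N \<omega> \<and> (\<exists>i\<in>{1..N}. \<exists>j\<in>{1..N}. i \<noteq> j \<and> \<omega> i \<inter> \<omega> j \<noteq> {})"


section \<open>Function spaces and localizing space decompositions\<close>

text \<open>The (essential) support of a function defined up to \<open>M\<close>-null sets. For \<open>M = count_space \<Omega>\<close>
  it is the closure of the set of points of \<open>\<Omega>\<close> where \<open>f\<close> does not vanish.\<close>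

definition ess_support :: "'a::topological_space measure \<Rightarrow> ('a \<Rightarrow> 'e::zero) \<Rightarrow> 'a set" where
  "ess_support M f = {x. \<forall>U. open U \<and> x \<in> U \<longrightarrow> \<not> (AE y in M. y \<in> U \<longrightarrow> f y = 0)}"

text \<open>A Hilbert space of functions on \<open>\<Omega>\<close>. The elements of \<open>'v\<close> are identified via \<open>fn\<close> with
  functions on \<open>\<Omega>\<close> modulo \<open>M\<close>-null sets: \<open>M = lebesgue_on \<Omega>\<close> gives spaces of Lebesgue or Sobolev
  type, \<open>M = count_space \<Omega>\<close> spaces of genuine pointwise functions. The functions take values in a
  vector space over the scalars, with scalar multiplication \<open>scaleE\<close>; scalar-valued functions are
  the case \<open>scaleE = times\<close>.\<close>

locale hilbert_function_space = hilbert_space scale ip + vals: vector_space scaleE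
  for scale :: "'k::real_or_complex \<Rightarrow> 'v::banach \<Rightarrow> 'v" and ip :: "'v \<Rightarrow> 'v \<Rightarrow> 'k"
    and scaleE :: "'k \<Rightarrow> 'e::ab_group_add \<Rightarrow> 'e" +
  fixes \<Omega> :: "(real ^ 'd) set" and M :: "(real ^ 'd) measure"
    and fn :: "'v \<Rightarrow> real ^ 'd \<Rightarrow> 'e"
  assumes space_M: "space M = \<Omega>"
    and sets_M: "sets (restrict_space borel \<Omega>) \<subseteq> sets M"
    and fn_add: "AE x in M. fn (\<phi> + \<psi>) x = fn \<phi> x + fn \<psi> x"
    and fn_scale: "AE x in M. fn (scale a \<phi>) x = scaleE a (fn \<phi> x)"
    and fn_inj: "(AE x in M. fn \<phi> x = fn \<psi> x) \<Longrightarrow> \<phi> = \<psi>"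

text \<open>The supports are required to lie in the closed subdomains, so that for instance
  \<open>H\<^sup>1\<^sub>0(\<omega>\<^sub>i)\<close> is an admissible local space for an open subdomain \<open>\<omega>\<^sub>i\<close>.
  The whole Hilbert space is \<open>UNIV :: 'v set\<close>.\<close>

locale localizing_space_decomposition = hilbert_function_space scale ip scaleE \<Omega> M fn
  for scale :: "'k::real_or_complex \<Rightarrow> 'v::banach \<Rightarrow> 'v" and ip :: "'v \<Rightarrow> 'v \<Rightarrow> 'k"
    and scaleE :: "'k \<Rightarrow> 'e::ab_group_add \<Rightarrow> 'e"
    and \<Omega> :: "(real ^ 'd) set" and M :: "(real ^ 'd) measure"
    and fn :: "'v \<Rightarrow> real ^ 'd \<Rightarrow> 'e" +
  fixes N :: nat and \<omega> :: "nat \<Rightarrow> (real ^ 'd) set"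
    and V :: "nat \<Rightarrow> 'v set" and P :: "nat \<Rightarrow> 'v \<Rightarrow> 'v"
  assumes domain: "open \<Omega>" "\<Omega> \<noteq> {}" "bounded \<Omega>" "connected \<Omega>" "smooth_boundary \<Omega>"
    and decomposition: "overlapping_decomposition \<Omega> N \<omega> \<or> nonoverlapping_decomposition \<Omega> N \<omega>"
    and subspaces: "i \<in> {1..N} \<Longrightarrow> module.subspace scale (V i)"
    and sum_subspaces: "{\<Sum>i=1..N. v i | v. \<forall>i\<in>{1..N}. v i \<in> V i} = UNIV"
    and supports: "i \<in> {1..N} \<Longrightarrow> \<phi> \<in> V i \<Longrightarrow> ess_support M (fn \<phi>) \<subseteq> closure (\<omega> i)"
    and P_linear: "i \<in> {1..N} \<Longrightarrow> Vector_Spaces.linear scale scale (P i)"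
    and P_range: "i \<in> {1..N} \<Longrightarrow> P i \<phi> \<in> V i"
    and P_sum: "(\<Sum>i=1..N. P i \<phi>) = \<phi>"


section \<open>Dual norms and the constants\<close>

text \<open>Suprema are taken in \<open>ennreal\<close>: the supremum over the empty set is \<open>0\<close>, unbounded suprema
  are \<open>\<infinity>\<close>, and \<open>0 * \<infinity> = 0\<close>.\<close>

definition dual_norm :: "'v::real_normed_vector set \<Rightarrow> ('v \<Rightarrow> 'k::real_normed_vector) \<Rightarrow> ennreal" where
  "dual_norm W F = (SUP \<phi>\<in>W - {0}. ennreal (norm (F \<phi>) / norm \<phi>))"

definition local_const ::
  "('v::real_normed_vector \<Rightarrow> 'v \<Rightarrow> 'k::zero) \<Rightarrow> 'v set \<Rightarrow> 'v set \<Rightarrow> ('v \<Rightarrow> 'v) \<Rightarrow> ennreal" where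
  "local_const ip Vt W Q =
     (SUP \<phi>\<in>UNIV - {0}. ennreal (norm (Q \<phi> - orth_proj ip (Vt \<inter> W) (Q \<phi>)) / norm \<phi>))"

definition ennreal_sqrt :: "ennreal \<Rightarrow> ennreal" where
  "ennreal_sqrt x = (if x = \<infinity> then \<infinity> else ennreal (sqrt (enn2real x)))"

end

theory Submission
  imports Defs
begin

text \<open>Write \<open>c\<^sub>i\<close> for the local constants, \<open>d\<^sub>i\<close> for the dual norm of \<open>F\<close> over \<open>V\<^sub>i\<close> and \<open>D\<close> for
  its dual norm over the whole space. Let \<open>u\<^sub>i\<close> be \<open>P\<^sub>i \<phi>\<close> minus its orthogonal projection onto
  \<open>Vt \<inter> V\<^sub>i\<close>. Then \<open>u\<^sub>i\<close> lies in \<open>V\<^sub>i\<close>, and since \<open>F\<close> vanishes on \<open>Vt\<close> and the \<open>P\<^sub>i \<phi>\<close> add up to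
  \<open>\<phi>\<close>, \<open>F \<phi> = (\<Sum>i. F u\<^sub>i)\<close>. Estimating each term by
  \<open>norm (F u\<^sub>i) / norm \<phi> = (norm u\<^sub>i / norm \<phi>) * (norm (F u\<^sub>i) / norm u\<^sub>i) \<le> c\<^sub>i * d\<^sub>i\<close> gives the first
  inequality (\<open>dual_norm_le_sum_local\<close>).

  For the second one, the Cauchy--Schwarz inequality (\<open>ennreal_Cauchy_Schwarz\<close>) reduces the claim
  to \<open>(\<Sum>i. d\<^sub>i\<^sup>2) \<le> J * D\<^sup>2\<close> (\<open>sum_dual_norm_coloured_le\<close>), which follows by adding up the bound
  \<open>(\<Sum>i. d\<^sub>i\<^sup>2) \<le> D\<^sup>2\<close> over single classes of mutually orthogonal spaces
  (\<open>sum_dual_norm_orthogonal_le\<close>). In a single class, choose any \<open>y\<^sub>i \<in> V\<^sub>i\<close> and test the functional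
  with \<open>w = (\<Sum>i. (conjg (F y\<^sub>i) / (norm y\<^sub>i)\<^sup>2) y\<^sub>i)\<close>: both \<open>F w\<close> and, by Pythagoras, \<open>(norm w)\<^sup>2\<close> equal
  \<open>S = (\<Sum>i. (norm (F y\<^sub>i) / norm y\<^sub>i)\<^sup>2)\<close>, so \<open>S \<le> D * sqrt S\<close> and hence \<open>S \<le> D\<^sup>2\<close>. Letting the \<open>y\<^sub>i\<close>
  run through maximizing sequences gives the bound, without any representation theorem for \<open>F\<close>.\<close>

section \<open>The Hermitian form\<close>

lemma conjg_zero [simp]: "conjg (0 :: 'a::real_or_complex) = 0"
  using conjg_add[of "0::'a" 0] by simp

lemma norm_conjg [simp]: "norm (conjg (x :: 'a::real_or_complex)) = norm x"
proof (cases "x = 0")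
  case False
  have "norm x * norm (conjg x) = norm x * norm x"
    using arg_cong[OF mult_conjg[of x], of norm]
    by (simp add: norm_mult power2_eq_square)
  with False show ?thesis by simp
qed simp

lemma mult_conjg_of_real: "x * conjg x = (of_real ((norm x)\<^sup>2) :: 'a::real_or_complex)"
  by (simp add: mult_conjg of_real_def)

context hilbert_space
begin

lemma ip_zero_right [simp]: "ip x 0 = 0"
  using ip_conjg[of x 0] ip_add_left[of 0 0 x] by simp

lemma ip_add_right: "ip x (y + z) = ip x y + ip x z"
  using ip_conjg[of x "y + z"] ip_conjg[of x y] ip_conjg[of x z]
  by (simp add: ip_add_left conjg_add)

lemma ip_scale_right: "ip x (scale a y) = conjg a * ip x y"
  using ip_conjg[of x "scale a y"] ip_conjg[of x y]
  by (simp add: ip_scale_left conjg_mult)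

lemma ip_diff_left: "ip (x - y) z = ip x z - ip y z"
  using ip_add_left[of "x - y" y z] by simp

lemma ip_diff_right: "ip x (y - z) = ip x y - ip x z"
  using ip_add_right[of x "y - z" z] by simp

lemma ip_sum_right: "ip x (sum f A) = (\<Sum>i\<in>A. ip x (f i))"
  by (induction A rule: infinite_finite_induct) (simp_all add: ip_add_right)

lemma ip_eq_zero_sym: "ip x y = 0 \<Longrightarrow> ip y x = 0"
  using ip_conjg[of y x] by simp

lemma norm_scale: "norm (scale a x) = norm a * norm x"
proof -
  have "(of_real ((norm (scale a x))\<^sup>2) :: 'k) = (a * conjg a) * ip x x"
    unfolding ip_self[symmetric] by (simp add: ip_scale_left ip_scale_right)
  also have "\<dots> = of_real ((norm a * norm x)\<^sup>2)"
    by (simp add: mult_conjg_of_real ip_self power_mult_distrib)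
  finally have "(norm (scale a x))\<^sup>2 = (norm a * norm x)\<^sup>2"
    by (simp only: of_real_eq_iff)
  then show ?thesis by simp
qed

lemma parallelogram:
  fixes x y :: 'v
  shows "(norm (x + y))\<^sup>2 + (norm (x - y))\<^sup>2 = 2 * (norm x)\<^sup>2 + 2 * (norm y)\<^sup>2"
proof -
  have "(of_real ((norm (x + y))\<^sup>2 + (norm (x - y))\<^sup>2) :: 'k)
      = ip (x + y) (x + y) + ip (x - y) (x - y)"
    by (simp add: ip_self)
  also have "\<dots> = 2 * ip x x + 2 * ip y y"
    by (simp add: ip_add_left ip_add_right ip_diff_left ip_diff_right)
  also have "\<dots> = of_real (2 * (norm x)\<^sup>2 + 2 * (norm y)\<^sup>2)"
    by (simp add: ip_self)
  finally have "(of_real ((norm (x + y))\<^sup>2 + (norm (x - y))\<^sup>2) :: 'k)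
      = of_real (2 * (norm x)\<^sup>2 + 2 * (norm y)\<^sup>2)" .
  then show ?thesis by (simp only: of_real_eq_iff)
qed

lemma Pythagoras: "ip x y = 0 \<Longrightarrow> (norm (x + y))\<^sup>2 = (norm x)\<^sup>2 + (norm y)\<^sup>2"
proof -
  assume "ip x y = 0"
  then have "(of_real ((norm (x + y))\<^sup>2) :: 'k) = of_real ((norm x)\<^sup>2 + (norm y)\<^sup>2)"
    unfolding of_real_add ip_self[symmetric]
    by (simp add: ip_add_left ip_add_right ip_eq_zero_sym)
  then show ?thesis by (simp only: of_real_eq_iff)
qed

lemma Pythagoras_sum:
  assumes "finite I" and "\<And>i j. i \<in> I \<Longrightarrow> j \<in> I \<Longrightarrow> i \<noteq> j \<Longrightarrow> ip (v i) (v j) = 0"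
  shows "(norm (\<Sum>i\<in>I. v i))\<^sup>2 = (\<Sum>i\<in>I. (norm (v i))\<^sup>2)"
  using assms
proof (induction I rule: finite_induct)
  case (insert a I)
  have "ip (v a) (v i) = 0" if "i \<in> I" for i
    using that insert.hyps insert.prems[of a i] by auto
  then have "ip (v a) (\<Sum>i\<in>I. v i) = 0"
    by (simp add: ip_sum_right)
  then show ?case
    using insert.hyps insert.IH insert.prems by (simp add: Pythagoras)
qed simp


section \<open>The orthogonal projection onto a closed subspace\<close>

lemma nearest_point_exists:
  assumes W: "module.subspace scale W" and closed: "closed W"
  shows "\<exists>p\<in>W. \<forall>w\<in>W. (norm (x - p))\<^sup>2 \<le> (norm (x - w))\<^sup>2"
proof -
  define d where "d = (INF w\<in>W. (norm (x - w))\<^sup>2)"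
  have ne: "W \<noteq> {}" using subspace_0[OF W] by blast
  have bdd: "bdd_below ((\<lambda>w. (norm (x - w))\<^sup>2) ` W)"
    by (rule bdd_belowI[of _ 0]) auto
  have d_le: "d \<le> (norm (x - w))\<^sup>2" if "w \<in> W" for w
    unfolding d_def by (rule cINF_lower[OF bdd that])
  have "\<exists>w\<in>W. (norm (x - w))\<^sup>2 < d + 1 / real (Suc n)" for n
  proof -
    have "d < d + 1 / real (Suc n)" by simp
    then show ?thesis
      unfolding d_def cINF_less_iff[OF ne bdd] .
  qed
  then obtain y where y: "\<And>n. y n \<in> W" "\<And>n. (norm (x - y n))\<^sup>2 < d + 1 / real (Suc n)"
    by metis
  \<comment> \<open>The midpoint of \<open>y n\<close> and \<open>y m\<close> is at squared distance at least \<open>d\<close> from \<open>x\<close>, so the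
    parallelogram law makes the minimizing sequence Cauchy.\<close>
  have est: "(norm (y m - y n))\<^sup>2 \<le> 2 / real (Suc n) + 2 / real (Suc m)" for m n
  proof -
    have "(1/2) *\<^sub>R (y n + y m) \<in> W"
      using subspace_scale[OF W subspace_add[OF W y(1)[of n] y(1)[of m]], of "of_real (1/2)"]
      by (simp only: scale_of_real)
    then have "d \<le> (norm (x - (1/2) *\<^sub>R (y n + y m)))\<^sup>2" by (rule d_le)
    moreover have "x - y n + (x - y m) = 2 *\<^sub>R (x - (1/2) *\<^sub>R (y n + y m))"
      by (simp add: scaleR_right_diff_distrib scaleR_2)
    then have "(norm (x - y n + (x - y m)))\<^sup>2 = 4 * (norm (x - (1/2) *\<^sub>R (y n + y m)))\<^sup>2"
      by (simp add: power_mult_distrib)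
    moreover have "x - y n - (x - y m) = y m - y n" by simp
    ultimately show ?thesis
      using parallelogram[of "x - y n" "x - y m"] y(2)[of n] y(2)[of m] by simp
  qed
  have "Cauchy y"
  proof (rule metric_CauchyI)
    fix e :: real assume "0 < e"
    then obtain K where K: "4 / e\<^sup>2 < real (Suc K)"
      by (meson reals_Archimedean2 less_trans of_nat_less_iff lessI)
    have "dist (y m) (y n) < e" if "m \<ge> K" "n \<ge> K" for m n
    proof -
      have "2 / real (Suc n) \<le> 2 / real (Suc K)" "2 / real (Suc m) \<le> 2 / real (Suc K)"
        using that by (auto intro!: divide_left_mono)
      then have "(norm (y m - y n))\<^sup>2 \<le> 4 / real (Suc K)"
        using est[of m n] by simp
      also have "\<dots> < e\<^sup>2"
        using K \<open>0 < e\<close> by (simp add: field_simps del: of_nat_Suc)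
      finally show ?thesis
        using \<open>0 < e\<close> by (simp add: dist_norm power_less_imp_less_base)
    qed
    then show "\<exists>K. \<forall>m\<ge>K. \<forall>n\<ge>K. dist (y m) (y n) < e" by blast
  qed
  then obtain p where p: "y \<longlonglongrightarrow> p"
    using Cauchy_convergent convergent_def by blast
  have "p \<in> W"
    using closed_sequentially[OF closed] y(1) p by blast
  moreover have "(norm (x - p))\<^sup>2 \<le> d"
  proof (rule LIMSEQ_le)
    show "(\<lambda>n. (norm (x - y n))\<^sup>2) \<longlonglongrightarrow> (norm (x - p))\<^sup>2"
      by (intro tendsto_intros p)
    show "(\<lambda>n. d + 1 / real (Suc n)) \<longlonglongrightarrow> d"
      using tendsto_add[OF tendsto_const[of d] lim_inverse_n'[THEN LIMSEQ_Suc]] by simp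
    show "\<exists>K. \<forall>n\<ge>K. (norm (x - y n))\<^sup>2 \<le> d + 1 / real (Suc n)"
      using y(2) less_imp_le by blast
  qed
  ultimately show ?thesis using d_le by (meson order_trans)
qed

lemma nearest_point_orthogonal:
  assumes W: "module.subspace scale W" and p: "p \<in> W" and w: "w \<in> W"
    and min: "\<And>w. w \<in> W \<Longrightarrow> (norm (x - p))\<^sup>2 \<le> (norm (x - w))\<^sup>2"
  shows "ip (x - p) w = 0"
proof (cases "w = 0")
  case False
  \<comment> \<open>\<open>scale c w\<close> is the component of \<open>x - p\<close> along \<open>w\<close>; moving \<open>p\<close> by it cannot decrease the
    distance to \<open>x\<close>, so it vanishes.\<close>
  define c where "c = ip (x - p) w / of_real ((norm w)\<^sup>2)"
  have "ip (x - p - scale c w) w = 0"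
    using False by (simp add: ip_diff_left[of "x - p"] ip_scale_left ip_self c_def)
  then have "ip (x - p - scale c w) (scale c w) = 0"
    by (simp add: ip_scale_right)
  then have "(norm (x - p))\<^sup>2 = (norm (x - p - scale c w))\<^sup>2 + (norm (scale c w))\<^sup>2"
    using Pythagoras[of "x - p - scale c w" "scale c w"] by simp
  moreover have "p + scale c w \<in> W"
    by (intro subspace_add[OF W] subspace_scale[OF W] p w)
  then have "(norm (x - p))\<^sup>2 \<le> (norm (x - p - scale c w))\<^sup>2"
    using min[of "p + scale c w"] by (simp add: diff_diff_eq)
  ultimately have "norm (scale c w) = 0"
    by simp
  with False have "c = 0" by (simp add: norm_scale)
  with False show ?thesis by (simp add: c_def)
qed simp

lemma orth_proj_in:
  assumes W: "module.subspace scale W" and closed: "closed W"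
  shows "orth_proj ip W x \<in> W"
proof -
  obtain p where p: "p \<in> W" "\<And>w. w \<in> W \<Longrightarrow> ip (x - p) w = 0"
    using nearest_point_exists[OF assms, of x] nearest_point_orthogonal[OF W] by metis
  have unique: "q = p" if q: "q \<in> W" "\<forall>w\<in>W. ip (x - q) w = 0" for q
  proof -
    have "q - p \<in> W" using W q(1) p(1) by (rule subspace_diff)
    then have "ip (x - p) (q - p) - ip (x - q) (q - p) = 0"
      using p(2) q(2) by simp
    then have "ip (q - p) (q - p) = 0"
      by (simp flip: ip_diff_left)
    then show ?thesis by (simp add: ip_self)
  qed
  have "orth_proj ip W x = p"
    unfolding orth_proj_def
  proof (rule the_equality)
    show "p \<in> W \<and> (\<forall>w\<in>W. ip (x - p) w = 0)" using p by blast
  qed (use unique in blast)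
  with p show ?thesis by simp
qed


section \<open>Dual norms on mutually orthogonal subspaces\<close>

text \<open>Indices with \<open>y i = 0\<close> are harmless: both the quotient and the coefficient \<open>a i\<close> below are then
  \<open>0\<close>, since division by zero yields zero.\<close>

lemma sum_quotients_orthogonal_le:
  assumes F: "Vector_Spaces.linear scale times F" and "finite I"
    and orth: "\<And>i j. i \<in> I \<Longrightarrow> j \<in> I \<Longrightarrow> i \<noteq> j \<Longrightarrow> ip (y i) (y j) = 0"
    and bound: "\<And>z. norm (F z) \<le> D * norm z"
  shows "(\<Sum>i\<in>I. (norm (F (y i)) / norm (y i))\<^sup>2) \<le> D\<^sup>2"
proof -
  interpret F: Vector_Spaces.linear scale times F by (rule F)
  \<comment> \<open>The coefficients are chosen so that \<open>F w\<close> and \<open>(norm w)\<^sup>2\<close> both equal \<open>S\<close>.\<close>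
  define a where "a i = conjg (F (y i)) / of_real ((norm (y i))\<^sup>2)" for i
  define w where "w = (\<Sum>i\<in>I. scale (a i) (y i))"
  define S where "S = (\<Sum>i\<in>I. (norm (F (y i)) / norm (y i))\<^sup>2)"
  have S: "0 \<le> S" unfolding S_def by (intro sum_nonneg) simp
  have "a i * F (y i) = of_real ((norm (F (y i)) / norm (y i))\<^sup>2)" for i
    using mult_conjg_of_real[of "F (y i)"] by (simp add: a_def mult.commute power_divide)
  then have Fw: "F w = of_real S"
    by (simp add: w_def S_def F.sum F.scale)
  have "(norm w)\<^sup>2 = (\<Sum>i\<in>I. (norm (scale (a i) (y i)))\<^sup>2)"
    unfolding w_def using orth
    by (intro Pythagoras_sum \<open>finite I\<close>) (simp add: ip_scale_left ip_scale_right)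
  also have "\<dots> = S"
    unfolding S_def
  proof (rule sum.cong)
    fix i
    have "norm (scale (a i) (y i)) = norm (F (y i)) / norm (y i)"
      by (simp add: norm_scale a_def norm_divide norm_mult power2_eq_square)
    then show "(norm (scale (a i) (y i)))\<^sup>2 = (norm (F (y i)) / norm (y i))\<^sup>2"
      by simp
  qed simp
  finally have "(norm w)\<^sup>2 = S" .
  then have nw: "norm w = sqrt S" by (simp add: real_sqrt_unique)
  have "sqrt S * sqrt S \<le> D * sqrt S"
    using bound[of w] S by (simp add: Fw nw)
  then have "sqrt S \<le> D \<or> S = 0"
    using S mult_right_le_imp_le[of "sqrt S" "sqrt S" D] by fastforce
  then have "S \<le> D\<^sup>2"
  proof
    assume "sqrt S \<le> D"
    then have "(sqrt S)\<^sup>2 \<le> D\<^sup>2" using S by (intro power_mono) auto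
    with S show ?thesis by simp
  qed simp
  then show ?thesis by (simp only: S_def)
qed

end

lemma dual_norm_upper: "\<phi> \<in> W \<Longrightarrow> ennreal (norm (F \<phi>) / norm \<phi>) \<le> dual_norm W F"
  unfolding dual_norm_def by (cases "\<phi> = 0") (auto intro: SUP_upper)

text \<open>The quotient at \<open>0\<close> is \<open>0\<close>, so the zero vector may be included in the supremum. This makes the
  index set nonempty even for the trivial subspace.\<close>

lemma dual_norm_maximizing_sequence:
  assumes "0 \<in> W"
  shows "\<exists>y. (\<forall>n. y n \<in> W) \<and>
    (\<lambda>n. ennreal (norm (F (y n)) / norm (y n))) \<longlonglongrightarrow> dual_norm W F"
proof -
  define g where "g = (\<lambda>\<phi>. ennreal (norm (F \<phi>) / norm \<phi>))"
  have "dual_norm W F = Sup (g ` W)"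
  proof (rule antisym)
    show "dual_norm W F \<le> Sup (g ` W)"
      unfolding dual_norm_def g_def by (rule SUP_subset_mono) auto
    show "Sup (g ` W) \<le> dual_norm W F"
      unfolding g_def by (rule SUP_least) (rule dual_norm_upper)
  qed
  moreover obtain f :: "nat \<Rightarrow> ennreal" where
    f: "incseq f" "range f \<subseteq> g ` W" "Sup (g ` W) = (SUP n. f n)"
    using ennreal_Sup_countable_SUP[of "g ` W"] assms by auto
  moreover have "\<forall>n. \<exists>y\<in>W. f n = g y"
    using f(2) by auto
  then obtain y where "\<And>n. y n \<in> W" "\<And>n. f n = g (y n)"
    by metis
  moreover from this(2) have "f = (\<lambda>n. g (y n))" by blast
  ultimately have "\<forall>n. y n \<in> W" "(\<lambda>n. g (y n)) \<longlonglongrightarrow> dual_norm W F"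
    using LIMSEQ_SUP[OF f(1)] by simp_all
  then show ?thesis unfolding g_def by blast
qed

lemma (in hilbert_space) sum_dual_norm_orthogonal_le:
  assumes F: "Vector_Spaces.linear scale times F" and "finite I"
    and zero: "\<And>i. i \<in> I \<Longrightarrow> 0 \<in> V i"
    and orth: "\<And>i j. i \<in> I \<Longrightarrow> j \<in> I \<Longrightarrow> i \<noteq> j \<Longrightarrow> orthogonal_sets ip (V i) (V j)"
  shows "(\<Sum>i\<in>I. (dual_norm (V i) F)\<^sup>2) \<le> (dual_norm UNIV F)\<^sup>2"
proof (cases "dual_norm UNIV F")
  case (real D)
  have bound: "norm (F z) \<le> D * norm z" for z
  proof (cases "z = 0")
    case True
    interpret F: Vector_Spaces.linear scale times F by (rule F)
    show ?thesis using True F.zero by simp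
  next
    case False
    then show ?thesis
      using dual_norm_upper[of z UNIV F] real by (simp add: field_simps)
  qed
  have "\<forall>i\<in>I. \<exists>y. (\<forall>n. y n \<in> V i) \<and>
      (\<lambda>n. ennreal (norm (F (y n)) / norm (y n))) \<longlonglongrightarrow> dual_norm (V i) F"
    using dual_norm_maximizing_sequence zero by blast
  then obtain y where y: "\<And>i n. i \<in> I \<Longrightarrow> y i n \<in> V i"
      "\<And>i. i \<in> I \<Longrightarrow> (\<lambda>n. ennreal (norm (F (y i n)) / norm (y i n))) \<longlonglongrightarrow> dual_norm (V i) F"
    by metis
  have "(\<lambda>n. \<Sum>i\<in>I. (ennreal (norm (F (y i n)) / norm (y i n)))\<^sup>2)
      \<longlonglongrightarrow> (\<Sum>i\<in>I. (dual_norm (V i) F)\<^sup>2)"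
    unfolding power2_eq_square
    by (intro tendsto_sum tendsto_mult_ennreal y(2)) auto
  moreover have "(\<Sum>i\<in>I. (ennreal (norm (F (y i n)) / norm (y i n)))\<^sup>2) \<le> ennreal (D\<^sup>2)" for n
  proof -
    have "ip (y i n) (y j n) = 0" if "i \<in> I" "j \<in> I" "i \<noteq> j" for i j
      using orth[OF that] y(1) that by (auto simp: orthogonal_sets_def)
    then have "(\<Sum>i\<in>I. (norm (F (y i n)) / norm (y i n))\<^sup>2) \<le> D\<^sup>2"
      by (intro sum_quotients_orthogonal_le[OF F \<open>finite I\<close>] bound)
    then show ?thesis
      by (simp add: ennreal_power sum_ennreal ennreal_leI)
  qed
  ultimately have "(\<Sum>i\<in>I. (dual_norm (V i) F)\<^sup>2) \<le> ennreal (D\<^sup>2)"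
    by (intro LIMSEQ_le_const2) auto
  then show ?thesis using real by (simp add: ennreal_power)
qed simp


section \<open>The Cauchy--Schwarz inequality for extended nonnegative reals\<close>

lemma ennreal_sqrt_mono: "x \<le> y \<Longrightarrow> ennreal_sqrt x \<le> ennreal_sqrt y"
  by (cases x; cases y) (auto simp: ennreal_sqrt_def top_unique ennreal_leI)

lemma ennreal_sqrt_mult_square:
  "ennreal_sqrt (of_nat n * x\<^sup>2) = ennreal (sqrt (real n)) * x"
proof (cases x)
  case (real r)
  then have "of_nat n * x\<^sup>2 = ennreal (real n * r\<^sup>2)"
    by (simp add: ennreal_mult ennreal_power ennreal_of_nat_eq_real_of_nat)
  then have "ennreal_sqrt (of_nat n * x\<^sup>2) = ennreal (sqrt (real n) * r)"
    using real by (simp add: ennreal_sqrt_def real_sqrt_mult)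
  then show ?thesis
    using real by (simp add: ennreal_mult)
next
  case top
  then show ?thesis
    by (cases "n = 0") (auto simp: ennreal_sqrt_def ennreal_mult_top)
qed

lemma ennreal_Cauchy_Schwarz:
  fixes c d :: "'i \<Rightarrow> ennreal"
  assumes "finite I"
  shows "(\<Sum>i\<in>I. c i * d i) \<le> ennreal_sqrt (\<Sum>i\<in>I. (c i)\<^sup>2) * ennreal_sqrt (\<Sum>i\<in>I. (d i)\<^sup>2)"
proof -
  let ?C = "\<Sum>i\<in>I. (c i)\<^sup>2" and ?D = "\<Sum>i\<in>I. (d i)\<^sup>2"
  have sqrt0: "ennreal_sqrt x = 0 \<longleftrightarrow> x = 0" for x
    by (cases x) (auto simp: ennreal_sqrt_def)
  consider "?C = 0 \<or> ?D = 0" | "?C \<noteq> 0" "?D \<noteq> 0" "?C = \<infinity> \<or> ?D = \<infinity>"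
    | "?C < \<infinity>" "?D < \<infinity>"
    by (metis infinity_ennreal_def less_top)
  then show ?thesis
  proof cases
    case 1
    then have "\<forall>i\<in>I. c i * d i = 0"
      using assms by auto
    then have "(\<Sum>i\<in>I. c i * d i) = 0" by (intro sum.neutral) auto
    then show ?thesis by simp
  next
    case 2
    then have "ennreal_sqrt ?C * ennreal_sqrt ?D = \<infinity>"
      using sqrt0 by (auto simp: ennreal_sqrt_def ennreal_mult_eq_top_iff)
    then show ?thesis by simp
  next
    case 3
    define a b where "a i = enn2real (c i)" and "b i = enn2real (d i)" for i
    have fin: "c i = ennreal (a i)" "d i = ennreal (b i)" if "i \<in> I" for i
    proof -
      have "(c i)\<^sup>2 \<le> ?C" "(d i)\<^sup>2 \<le> ?D"
        using that assms by (auto intro: member_le_sum)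
      then have "(c i)\<^sup>2 < \<infinity>" "(d i)\<^sup>2 < \<infinity>"
        using 3 by (auto intro: order_le_less_trans)
      then show "c i = ennreal (a i)" "d i = ennreal (b i)"
        by (simp_all add: a_def b_def power_less_top_ennreal)
    qed
    have nn: "0 \<le> a i" "0 \<le> b i" for i by (simp_all add: a_def b_def)
    have "?C = ennreal (\<Sum>i\<in>I. (a i)\<^sup>2)" "?D = ennreal (\<Sum>i\<in>I. (b i)\<^sup>2)"
      using fin nn by (simp_all add: ennreal_power flip: sum_ennreal)
    then have "ennreal_sqrt ?C * ennreal_sqrt ?D = ennreal (L2_set a I * L2_set b I)"
      by (simp add: ennreal_sqrt_def L2_set_def ennreal_mult sum_nonneg)
    moreover have "(\<Sum>i\<in>I. c i * d i) = ennreal (\<Sum>i\<in>I. \<bar>a i\<bar> * \<bar>b i\<bar>)"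
      using fin nn by (simp add: ennreal_mult flip: sum_ennreal)
    ultimately show ?thesis
      using L2_set_mult_ineq[of a b I] by (simp add: ennreal_leI)
  qed
qed


section \<open>The two-sided estimate\<close>

lemma (in localizing_space_decomposition) dual_norm_le_sum_local:
  assumes Vt: "module.subspace scale Vt" and closed: "\<And>i. i \<in> {1..N} \<Longrightarrow> closed (Vt \<inter> V i)"
    and F: "Vector_Spaces.linear scale times F" and van: "\<And>\<phi>. \<phi> \<in> Vt \<Longrightarrow> F \<phi> = 0"
  shows "dual_norm UNIV F \<le> (\<Sum>i=1..N. local_const ip Vt (V i) (P i) * dual_norm (V i) F)"
  unfolding dual_norm_def[of UNIV]
proof (rule SUP_least)
  fix \<phi> :: 'v assume "\<phi> \<in> UNIV - {0}"
  then have \<phi>: "\<phi> \<noteq> 0" by simp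
  interpret F: Vector_Spaces.linear scale times F by (rule F)
  define u where "u i = P i \<phi> - orth_proj ip (Vt \<inter> V i) (P i \<phi>)" for i
  have proj: "orth_proj ip (Vt \<inter> V i) (P i \<phi>) \<in> Vt \<inter> V i" if "i \<in> {1..N}" for i
    using subspace_inter[OF Vt subspaces[OF that]] closed[OF that] by (rule orth_proj_in)
  have u: "u i \<in> V i" "F (u i) = F (P i \<phi>)" if "i \<in> {1..N}" for i
    using proj[OF that] subspaces[OF that] P_range[OF that, of \<phi>] van
    by (auto simp: u_def F.diff intro: subspace_diff)
  have "F \<phi> = F (\<Sum>i=1..N. P i \<phi>)" by (simp only: P_sum)
  also have "\<dots> = (\<Sum>i=1..N. F (u i))"
    using u(2) by (simp add: F.sum)
  finally have "norm (F \<phi>) / norm \<phi> \<le> (\<Sum>i=1..N. norm (F (u i)) / norm \<phi>)"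
    by (simp add: norm_sum divide_right_mono flip: sum_divide_distrib)
  then have "ennreal (norm (F \<phi>) / norm \<phi>) \<le> (\<Sum>i=1..N. ennreal (norm (F (u i)) / norm \<phi>))"
    by (simp add: sum_ennreal ennreal_leI)
  also have "\<dots> \<le> (\<Sum>i=1..N. local_const ip Vt (V i) (P i) * dual_norm (V i) F)"
  proof (rule sum_mono)
    fix i assume i: "i \<in> {1..N}"
    have "norm (F (u i)) / norm \<phi> = norm (u i) / norm \<phi> * (norm (F (u i)) / norm (u i))"
      using F.zero by (cases "u i = 0") auto
    then have "ennreal (norm (F (u i)) / norm \<phi>)
        = ennreal (norm (u i) / norm \<phi>) * ennreal (norm (F (u i)) / norm (u i))"
      by (simp only: ennreal_mult divide_nonneg_nonneg norm_ge_zero)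
    also have "\<dots> \<le> local_const ip Vt (V i) (P i) * dual_norm (V i) F"
    proof (rule mult_mono)
      show "ennreal (norm (u i) / norm \<phi>) \<le> local_const ip Vt (V i) (P i)"
        unfolding local_const_def u_def by (rule SUP_upper) (use \<phi> in simp)
    qed (use u(1)[OF i] in \<open>auto intro: dual_norm_upper\<close>)
    finally show "ennreal (norm (F (u i)) / norm \<phi>)
      \<le> local_const ip Vt (V i) (P i) * dual_norm (V i) F" .
  qed
  finally show "ennreal (norm (F \<phi>) / norm \<phi>)
    \<le> (\<Sum>i=1..N. local_const ip Vt (V i) (P i) * dual_norm (V i) F)" .
qed

lemma (in hilbert_space) sum_dual_norm_coloured_le:
  assumes F: "Vector_Spaces.linear scale times F"
    and "finite I" and cover: "I = (\<Union>k\<in>{1..J}. \<Upsilon> k)" and disj: "disjoint_family_on \<Upsilon> {1..J}"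
    and zero: "\<And>i. i \<in> I \<Longrightarrow> 0 \<in> V i"
    and orth: "\<And>k i j. k \<in> {1..J} \<Longrightarrow> i \<in> \<Upsilon> k \<Longrightarrow> j \<in> \<Upsilon> k \<Longrightarrow> i \<noteq> j \<Longrightarrow>
      orthogonal_sets ip (V i) (V j)"
  shows "(\<Sum>i\<in>I. (dual_norm (V i) F)\<^sup>2) \<le> of_nat J * (dual_norm UNIV F)\<^sup>2"
proof -
  have fin: "finite (\<Upsilon> k)" if "k \<in> {1..J}" for k
    using \<open>finite I\<close> that unfolding cover by (meson UN_upper finite_subset)
  have "(\<Sum>i\<in>I. (dual_norm (V i) F)\<^sup>2) = (\<Sum>k\<in>{1..J}. \<Sum>i\<in>\<Upsilon> k. (dual_norm (V i) F)\<^sup>2)"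
    unfolding cover using fin disj
    by (intro sum.UNION_disjoint) (auto simp: disjoint_family_on_def)
  also have "\<dots> \<le> (\<Sum>k\<in>{1..J}. (dual_norm UNIV F)\<^sup>2)"
  proof (rule sum_mono)
    fix k assume k: "k \<in> {1..J}"
    then have "\<Upsilon> k \<subseteq> I" unfolding cover by blast
    then show "(\<Sum>i\<in>\<Upsilon> k. (dual_norm (V i) F)\<^sup>2) \<le> (dual_norm UNIV F)\<^sup>2"
      using zero orth[OF k] by (intro sum_dual_norm_orthogonal_le[OF F fin[OF k]]) auto
  qed
  finally show ?thesis by simp
qed

theorem proposition4p2p2:
  fixes scale :: "'k::real_or_complex \<Rightarrow> 'v::banach \<Rightarrow> 'v" and ip :: "'v \<Rightarrow> 'v \<Rightarrow> 'k"
    and scaleE :: "'k \<Rightarrow> 'e::ab_group_add \<Rightarrow> 'e"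
    and \<Omega> :: "(real ^ 'd) set" and M :: "(real ^ 'd) measure" and fn :: "'v \<Rightarrow> real ^ 'd \<Rightarrow> 'e"
    and N J :: nat and \<omega> :: "nat \<Rightarrow> (real ^ 'd) set"
    and V :: "nat \<Rightarrow> 'v set" and P :: "nat \<Rightarrow> 'v \<Rightarrow> 'v"
    and \<Upsilon> :: "nat \<Rightarrow> nat set" and Vt :: "'v set" and F :: "'v \<Rightarrow> 'k"
  assumes "localizing_space_decomposition scale ip scaleE \<Omega> M fn N \<omega> V P"
    and "{1..N} = (\<Union>k\<in>{1..J}. \<Upsilon> k)" and "disjoint_family_on \<Upsilon> {1..J}"
    and "\<And>k i j. k \<in> {1..J} \<Longrightarrow> i \<in> \<Upsilon> k \<Longrightarrow> j \<in> \<Upsilon> k \<Longrightarrow> i \<noteq> j \<Longrightarrow> orthogonal_sets ip (V i) (V j)"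
    and "module.subspace scale Vt"
    and "\<And>i. i \<in> {1..N} \<Longrightarrow> closed (Vt \<inter> V i)"
    and "Vector_Spaces.linear scale times F" and "continuous_on UNIV F"
    and "\<And>\<phi>. \<phi> \<in> Vt \<Longrightarrow> F \<phi> = 0"
  shows "dual_norm UNIV F \<le> (\<Sum>i=1..N. local_const ip Vt (V i) (P i) * dual_norm (V i) F) \<and>
    (\<Sum>i=1..N. local_const ip Vt (V i) (P i) * dual_norm (V i) F)
      \<le> ennreal_sqrt (\<Sum>i=1..N. (local_const ip Vt (V i) (P i))\<^sup>2) * ennreal (sqrt (real J)) * dual_norm UNIV F"
proof -
  interpret localizing_space_decomposition scale ip scaleE \<Omega> M fn N \<omega> V P
    by (rule assms(1))
  let ?c = "\<lambda>i. local_const ip Vt (V i) (P i)" and ?d = "\<lambda>i. dual_norm (V i) F"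
  have "(\<Sum>i=1..N. (?d i)\<^sup>2) \<le> of_nat J * (dual_norm UNIV F)\<^sup>2"
    by (rule sum_dual_norm_coloured_le[OF assms(7) finite_atLeastAtMost assms(2,3) _ assms(4)])
      (rule subspace_0[OF subspaces])
  then have "ennreal_sqrt (\<Sum>i=1..N. (?d i)\<^sup>2) \<le> ennreal (sqrt (real J)) * dual_norm UNIV F"
    using ennreal_sqrt_mono ennreal_sqrt_mult_square by metis
  then have "(\<Sum>i=1..N. ?c i * ?d i)
      \<le> ennreal_sqrt (\<Sum>i=1..N. (?c i)\<^sup>2) * (ennreal (sqrt (real J)) * dual_norm UNIV F)"
    by (intro order_trans[OF ennreal_Cauchy_Schwarz] mult_left_mono) auto
  then show ?thesis
    using dual_norm_le_sum_local[OF assms(5,6,7,9)] by (simp add: mult.assoc)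
qed

end
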